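(* For each Horn-$\mathcal{ALCHIQ}$ knowledge base $(\mathcal{T},\mathcal{A})$, the austere canonical model $\mathit{can}(\mathcal{T},\mathcal{A})$ is a core, i.e. every endomorphism of $\mathit{can}(\mathcal{T},\mathcal{A})$ is an embedding (a strong, injective homomorphism).
   Context: A homomorphism maps individuals to themselves and preserves concept and role atoms; it is strong if atoms hold exactly when they hold on the image. $\mathcal{T}$ is a normalised Horn-$\mathcal{ALCHIQ}$ TBox (concept inclusions $A_0\sqcap\dots\sqcap A_n\sqsubseteq B$, $A\sqsubseteq{\leq_1}r.B$, $A\sqsubseteq\forall r.B$, $A\sqsubseteq\exists r.B$, role inclusions $r\sqsubseteq r'$). For finite sets $M$ of concept names, $\sqcap M$ is the conjunction of its elements; $\exists(\sqcap R).(\sqcap N)$ is satisfied by $e$ iff some $e'$ is an $r$-successor of $e$ for all $r\in R$ and belongs to all $A\in N$. 2-types: $t\in\mathcal{P}(N_C)\times\mathcal{P}(\text{roles})\times\mathcal{P}(N_C)$; 1½-types: $u\in\mathcal{P}(\text{roles})\times\mathcal{P}(N_C)$; $\pi_i$ is the $i$-th projection; $\mathit{inv}(t)=(\pi_3(t),\{r^-\mid r\in\pi_2(t)\},\pi_1(t))$. The good successor configuration $\mathrm{succ}_{\mathcal{T}}(F)$ of a set $F$ of 2-types with equal first components is the unique set of 1½-types with: (R1) if $M\subseteq\pi_1(t)$, $t\in F$, $\mathcal{T}\models\sqcap M\sqsubseteq\exists(\sqcap R).(\sqcap N)$ and no $t\in F$ has $R\subseteq\pi_2(t)$ and $N\subseteq\pi_3(t)$,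 then some $u$ in it has $R\subseteq\pi_1(u)$, $N\subseteq\pi_2(u)$; (R2) each $u$ in it has $\mathcal{T}\models\sqcap M\sqsubseteq\exists(\sqcap\pi_1(u)).(\sqcap\pi_2(u))$ for some $M\subseteq\pi_1(t)$, $t\in F$; (R3) no two distinct $u,u'$ in it have $\pi_1(u)\subseteq\pi_1(u')$, $\pi_2(u)\subseteq\pi_2(u')$; (R4) no $u$ in it and $t\in F$ have $\pi_1(u)\subseteq\pi_2(t)$ and $\pi_2(u)\subseteq\pi_3(t)$. $t'$ is a child of $t$ iff $\pi_1(t')=\pi_3(t)$ and $(\pi_2(t'),\pi_3(t'))\in\mathrm{succ}_{\mathcal{T}}(\mathit{inv}(t))$. $\mathcal{A}_{\mathcal{T}}$ is the closure of $\mathcal{A}$ (on its individuals) under all non-existential consequences of $\mathcal{T}$: entailed conjunctions $A_0\sqcap\dots\sqcap A_n\sqsubseteq B$, axioms $A\sqsubseteq\forall r.B$, entailed role inclusions (also into inverses), and, when $A(a),A_1(a),\dots,A_n(a),r(a,b),B(b)$ hold with $A\sqsubseteq{\leq_1}r.B\in\mathcal{T}$ and $\mathcal{T}\models A_1\sqcap\dots\sqcap A_n\sqsubseteq\exists(r_1\sqcap\dots\sqcap r_m).(B_1\sqcap\dots\sqcap B_m)$ with $A=A_j$, $r=r_k$, adding all $B_i(b)$ and $r_i(a,b)$. $\mathit{can}(\mathcal{T},\mathcal{A})$ has domain the individuals of $\mathcal{A}$ plus words $ak_1\dots k_n$ ($k_i$ 2-types) where $\pi_1(k_1)$ is the set of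 concepts of $a$ in $\mathcal{A}_{\mathcal{T}}$, $(\pi_2(k_1),\pi_3(k_1))\in\mathrm{succ}_{\mathcal{T}}(T_a)$ with $T_a$ consisting of $(\text{concepts of }a,\emptyset,\emptyset)$ and, for every $\mathcal{A}_{\mathcal{T}}$-neighbour $b$ of $a$, $(\text{concepts of }a,\{r\mid r(a,b)\in\mathcal{A}_{\mathcal{T}}\},\text{concepts of }b)$, and each $k_{i+1}$ a child of $k_i$; individuals get their $\mathcal{A}_{\mathcal{T}}$ concepts and roles, a word $w$ gets the concepts in $\pi_3$ of its last 2-type, and $(w,wk)\in r$ iff $r\in\pi_2(k)$, $(wk,w)\in r$ iff $r^-\in\pi_2(k)$.
   Formalization: In entailed inclusions ⊓M ⊑ ∃(⊓R).(⊓N) the role set R is required to be non-empty; with empty R allowed the claim fails, e.g. for the empty TBox and ABox {A(a)}, where a gets a disconnected copy of itself that an endomorphism maps to a. *)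

theory Defs
  imports Main "HOL-Library.Countable_Set"
begin

section \<open>Normalised Horn-ALCHIQ: syntax and semantics\<close>

datatype 'r role = Name 'r | Inverse 'r

fun inv_role :: "'r role \<Rightarrow> 'r role" where
  "inv_role (Name r) = Inverse r"
| "inv_role (Inverse r) = Name r"

datatype ('c, 'r) tbox_axiom =
    Conj_Incl "'c set" 'c                \<comment> \<open>\<open>A\<^sub>0 \<sqinter> \<dots> \<sqinter> A\<^sub>n \<sqsubseteq> B\<close>\<close>
  | At_Most_One 'c "'r role" 'c          \<comment> \<open>\<open>A \<sqsubseteq> \<le>\<^sub>1 r. B\<close>\<close>
  | Forall 'c "'r role" 'c               \<comment> \<open>\<open>A \<sqsubseteq> \<forall> r. B\<close>\<close>
  | Exists 'c "'r role" 'c               \<comment> \<open>\<open>A \<sqsubseteq> \<exists> r. B\<close>\<close>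
  | Role_Incl "'r role" "'r role"        \<comment> \<open>\<open>r \<sqsubseteq> r'\<close>\<close>

definition normalised_tbox :: "('c, 'r) tbox_axiom set \<Rightarrow> bool" where
  "normalised_tbox T \<longleftrightarrow>
     finite T \<and> (\<forall>M B. Conj_Incl M B \<in> T \<longrightarrow> finite M \<and> M \<noteq> {})"

record ('d, 'c, 'r) interp =
  domain :: "'d set"
  cint :: "'c \<Rightarrow> 'd set"
  rint :: "'r \<Rightarrow> ('d \<times> 'd) set"

definition interpretation_wf :: "('d, 'c, 'r) interp \<Rightarrow> bool" where
  "interpretation_wf I \<longleftrightarrow>
     domain I \<noteq> {} \<and> (\<forall>A. cint I A \<subseteq> domain I) \<and> (\<forall>r. rint I r \<subseteq> domain I \<times> domain I)"

fun role_int :: "('d, 'c, 'r) interp \<Rightarrow> 'r role \<Rightarrow> ('d \<times> 'd) set" where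
  "role_int I (Name r) = rint I r"
| "role_int I (Inverse r) = (rint I r)\<inverse>"

definition conj_int :: "('d, 'c, 'r) interp \<Rightarrow> 'c set \<Rightarrow> 'd set" where
  "conj_int I M = {e \<in> domain I. \<forall>A\<in>M. e \<in> cint I A}"

definition ex_int :: "('d, 'c, 'r) interp \<Rightarrow> 'r role set \<Rightarrow> 'c set \<Rightarrow> 'd set" where
  "ex_int I R N =
     {e \<in> domain I. \<exists>e'. (\<forall>r\<in>R. (e, e') \<in> role_int I r) \<and> e' \<in> conj_int I N}"

fun satisfies :: "('d, 'c, 'r) interp \<Rightarrow> ('c, 'r) tbox_axiom \<Rightarrow> bool" where
  "satisfies I (Conj_Incl M B) \<longleftrightarrow> conj_int I M \<subseteq> cint I B"
| "satisfies I (At_Most_One A r B) \<longleftrightarrow>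
     (\<forall>e x y. e \<in> cint I A \<and> (e, x) \<in> role_int I r \<and> x \<in> cint I B
        \<and> (e, y) \<in> role_int I r \<and> y \<in> cint I B \<longrightarrow> x = y)"
| "satisfies I (Forall A r B) \<longleftrightarrow>
     (\<forall>e x. e \<in> cint I A \<and> (e, x) \<in> role_int I r \<longrightarrow> x \<in> cint I B)"
| "satisfies I (Exists A r B) \<longleftrightarrow>
     (\<forall>e \<in> cint I A. \<exists>x. (e, x) \<in> role_int I r \<and> x \<in> cint I B)"
| "satisfies I (Role_Incl r s) \<longleftrightarrow> role_int I r \<subseteq> role_int I s"

definition is_model :: "('d, 'c, 'r) interp \<Rightarrow> ('c, 'r) tbox_axiom set \<Rightarrow> bool" where
  "is_model I T \<longleftrightarrow> interpretation_wf I \<and> (\<forall>\<alpha>\<in>T. satisfies I \<alpha>)"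

text \<open>
  HOL cannot quantify over the domain types of interpretations inside a formula, so entailment
  ranges over interpretations whose domain is a non-empty set of natural numbers.  For a finite
  TBox this is no restriction (downward Loewenheim-Skolem); see the lemmas
  \<open>entails_conj_any_domain\<close>, \<open>entails_role_any_domain\<close> and \<open>entails_ex_any_domain\<close> below.
\<close>

definition entails_conj :: "('c, 'r) tbox_axiom set \<Rightarrow> 'c set \<Rightarrow> 'c \<Rightarrow> bool" where
  "entails_conj T M B \<longleftrightarrow> finite M \<and> M \<noteq> {} \<and>
     (\<forall>I :: (nat, 'c, 'r) interp. is_model I T \<longrightarrow> conj_int I M \<subseteq> cint I B)"

definition entails_role :: "('c, 'r) tbox_axiom set \<Rightarrow> 'r role \<Rightarrow> 'r role \<Rightarrow> bool" where
  "entails_role T r s \<longleftrightarrow>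
     (\<forall>I :: (nat, 'c, 'r) interp. is_model I T \<longrightarrow> role_int I r \<subseteq> role_int I s)"

text \<open>
  \<open>entails_ex T M R N\<close> is \<open>T \<Turnstile> \<sqinter>M \<sqsubseteq> \<exists>(\<sqinter>R). (\<sqinter>N)\<close>.  The role conjunction \<open>\<sqinter>R\<close> is over a non-empty
  set of roles.  An empty \<open>R\<close> would make \<open>\<exists>(\<sqinter>R). (\<sqinter>N)\<close> say that \<open>N\<close> is realised anywhere in the
  domain; then already the empty TBox with the ABox \<open>{A(a)}\<close> would give \<open>a\<close> a disconnected
  copy of itself as a ``successor'', and the canonical model would not be a core.
\<close>

definition entails_ex ::
  "('c, 'r) tbox_axiom set \<Rightarrow> 'c set \<Rightarrow> 'r role set \<Rightarrow> 'c set \<Rightarrow> bool" where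
  "entails_ex T M R N \<longleftrightarrow> finite M \<and> finite R \<and> R \<noteq> {} \<and> finite N \<and>
     (\<forall>I :: (nat, 'c, 'r) interp. is_model I T \<longrightarrow> conj_int I M \<subseteq> ex_int I R N)"

subsection \<open>Entailment does not depend on the domain type\<close>

lemma nat_submodel:
  fixes I :: "('d, 'c, 'r) interp"
  assumes fin: "finite T" and mod: "is_model I T" and xy: "x \<in> domain I" "y \<in> domain I"
  obtains J :: "(nat, 'c, 'r) interp" and D :: "'d set" and g :: "'d \<Rightarrow> nat" where
    "is_model J T" "x \<in> D" "y \<in> D" "D \<subseteq> domain I" "inj_on g D" "domain J = g ` D"
    "\<And>A z. z \<in> D \<Longrightarrow> g z \<in> cint J A \<longleftrightarrow> z \<in> cint I A"
    "\<And>r z z'. z \<in> D \<Longrightarrow> z' \<in> D \<Longrightarrow> (g z, g z') \<in> role_int J r \<longleftrightarrow> (z, z') \<in> role_int I r"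
proof -
  have wf: "\<And>A. cint I A \<subseteq> domain I" "\<And>r. rint I r \<subseteq> domain I \<times> domain I"
    using mod by (auto simp: is_model_def interpretation_wf_def)
  define P where "P \<alpha> z w \<longleftrightarrow> (\<exists>A r B. \<alpha> = Exists A r B \<and> (z, w) \<in> role_int I r \<and> w \<in> cint I B)"
    for \<alpha> z w
  define wit where "wit \<alpha> z = (if \<exists>w. P \<alpha> z w then SOME w. P \<alpha> z w else z)" for \<alpha> z
  define D where "D = (\<lambda>(as, s). foldr wit as s) ` (lists T \<times> {x, y})"
  have P_wit: "P \<alpha> z (wit \<alpha> z)" if "P \<alpha> z w" for \<alpha> z w
    using that unfolding wit_def by (metis someI_ex)
  have wit_dom: "wit \<alpha> z \<in> domain I" if "z \<in> domain I" for \<alpha> z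
  proof (cases "\<exists>w. P \<alpha> z w")
    case True
    then have "P \<alpha> z (wit \<alpha> z)" using P_wit by blast
    then show ?thesis using wf by (auto simp: P_def)
  next
    case False
    then show ?thesis using that by (simp add: wit_def)
  qed
  have D_dom: "D \<subseteq> domain I"
  proof -
    have "foldr wit as s \<in> domain I" if "s \<in> {x, y}" for as s
      using that xy by (induction as) (auto intro: wit_dom)
    then show ?thesis by (auto simp: D_def)
  qed
  have D_count: "countable D"
    unfolding D_def using fin by (intro countable_image countable_SIGMA countable_lists)
      (auto intro: countable_finite)
  have D_I: "foldr wit as s \<in> D" if "as \<in> lists T" "s \<in> {x, y}" for as s
    unfolding D_def using that by (intro image_eqI[where x = "(as, s)"]) auto
  have xyD: "x \<in> D" "y \<in> D"
    using D_I[of "[]" x] D_I[of "[]" y] by simp_all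
  have D_closed: "wit \<alpha> z \<in> D" if az: "\<alpha> \<in> T" "z \<in> D" for \<alpha> z
  proof -
    obtain as s where "as \<in> lists T" "s \<in> {x, y}" "z = foldr wit as s"
      using az(2) unfolding D_def by auto
    then show ?thesis
      using D_I[of "\<alpha> # as" s] az(1) by simp
  qed
  define g where "g = to_nat_on D"
  have inj: "inj_on g D" unfolding g_def using D_count by (rule inj_on_to_nat_on)
  define J :: "(nat, 'c, 'r) interp" where
    "J = \<lparr>domain = g ` D, cint = (\<lambda>A. g ` (D \<inter> cint I A)),
          rint = (\<lambda>r. map_prod g g ` (rint I r \<inter> D \<times> D))\<rparr>"
  have dJ: "domain J = g ` D" by (simp add: J_def)
  have cJ: "g z \<in> cint J A \<longleftrightarrow> z \<in> cint I A" if "z \<in> D" for A z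
    using that inj by (auto simp: J_def inj_on_def)
  have rJ: "(g z, g z') \<in> role_int J r \<longleftrightarrow> (z, z') \<in> role_int I r" if "z \<in> D" "z' \<in> D" for r z z'
  proof -
    have "(g z, g z') \<in> rint J p \<longleftrightarrow> (z, z') \<in> rint I p" if zz: "z \<in> D" "z' \<in> D" for p z z'
    proof
      assume "(g z, g z') \<in> rint J p"
      then obtain w w' where w: "(w, w') \<in> rint I p" "w \<in> D" "w' \<in> D" "g z = g w" "g z' = g w'"
        by (auto simp: J_def)
      then have "z = w" "z' = w'" using zz inj by (auto dest: inj_onD)
      then show "(z, z') \<in> rint I p" using w by simp
    next
      assume "(z, z') \<in> rint I p"
      then show "(g z, g z') \<in> rint J p" using zz by (auto simp: J_def)
    qed
    then show ?thesis using that by (cases r) auto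
  qed
  have wfJ: "interpretation_wf J"
    using xyD by (auto simp: interpretation_wf_def J_def)
  have cJD: "\<exists>z\<in>D. n = g z" if "n \<in> cint J A" for n A
    using that by (auto simp: J_def)
  have rJD: "(\<exists>z\<in>D. n = g z) \<and> (\<exists>z\<in>D. m = g z)" if "(n, m) \<in> role_int J r" for n m r
    using that by (cases r) (auto simp: J_def)
  have "satisfies J \<alpha>" if aT: "\<alpha> \<in> T" for \<alpha>
  proof -
    have sat: "satisfies I \<alpha>" using mod aT by (simp add: is_model_def)
    show ?thesis
    proof (cases \<alpha>)
      case (Conj_Incl M B)
      then show ?thesis using sat D_dom
        by (auto simp: conj_int_def dJ cJ subset_iff)
    next
      case (At_Most_One A r B)
      have "n1 = n2" if h: "e \<in> cint J A" "(e, n1) \<in> role_int J r" "n1 \<in> cint J B"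
        "(e, n2) \<in> role_int J r" "n2 \<in> cint J B" for e n1 n2
      proof -
        obtain z z1 z2 where z: "z \<in> D" "z1 \<in> D" "z2 \<in> D" "e = g z" "n1 = g z1" "n2 = g z2"
          using h cJD by metis
        then have "z \<in> cint I A" "(z, z1) \<in> role_int I r" "z1 \<in> cint I B"
          "(z, z2) \<in> role_int I r" "z2 \<in> cint I B"
          using h cJ rJ by auto
        then have "z1 = z2" using sat At_Most_One by auto
        then show ?thesis using z by simp
      qed
      then show ?thesis unfolding At_Most_One satisfies.simps by blast
    next
      case (Forall A r B)
      have "n \<in> cint J B" if h: "e \<in> cint J A" "(e, n) \<in> role_int J r" for e n
      proof -
        obtain z z1 where z: "z \<in> D" "z1 \<in> D" "e = g z" "n = g z1"
          using h(2) rJD by metis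
        then have "z \<in> cint I A" "(z, z1) \<in> role_int I r" using h cJ rJ by auto
        then have "z1 \<in> cint I B" using sat Forall by auto
        then show ?thesis using z cJ by simp
      qed
      then show ?thesis using Forall by auto
    next
      case (Exists A r B)
      have "\<exists>n. (e, n) \<in> role_int J r \<and> n \<in> cint J B" if h: "e \<in> cint J A" for e
      proof -
        obtain z where z: "z \<in> D" "e = g z" using h cJD by metis
        then have "z \<in> cint I A" using h cJ by auto
        then obtain w where "P \<alpha> z w" using sat Exists by (auto simp: P_def)
        then have "P \<alpha> z (wit \<alpha> z)" by (rule P_wit)
        then have "(z, wit \<alpha> z) \<in> role_int I r" "wit \<alpha> z \<in> cint I B"
          using Exists by (auto simp: P_def)
        moreover have "wit \<alpha> z \<in> D" using D_closed aT z by blast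
        ultimately show ?thesis using z cJ rJ by blast
      qed
      then show ?thesis using Exists by simp
    next
      case (Role_Incl r s)
      have "(n, m) \<in> role_int J s" if h: "(n, m) \<in> role_int J r" for n m
      proof -
        obtain z z1 where z: "z \<in> D" "z1 \<in> D" "n = g z" "m = g z1"
          using h rJD by metis
        then have "(z, z1) \<in> role_int I s" using h rJ sat Role_Incl by auto
        then show ?thesis using z rJ by simp
      qed
      then show ?thesis using Role_Incl by auto
    qed
  qed
  then have "is_model J T" using wfJ by (simp add: is_model_def)
  then show thesis by (rule that[OF _ xyD D_dom inj dJ cJ rJ])
qed

lemma entails_conj_any_domain:
  fixes I :: "('d, 'c, 'r) interp"
  assumes "finite T" "is_model I T" "entails_conj T M B"
  shows "conj_int I M \<subseteq> cint I B"
proof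
  fix x assume x: "x \<in> conj_int I M"
  then have xd: "x \<in> domain I" by (simp add: conj_int_def)
  obtain J :: "(nat, 'c, 'r) interp" and D g where J: "is_model J T" "x \<in> D" "x \<in> D"
    "D \<subseteq> domain I" "inj_on g D" "domain J = g ` D"
    and cJ: "\<And>A z. z \<in> D \<Longrightarrow> g z \<in> cint J A \<longleftrightarrow> z \<in> cint I A"
    and rJ: "\<And>r z z'. z \<in> D \<Longrightarrow> z' \<in> D \<Longrightarrow> (g z, g z') \<in> role_int J r \<longleftrightarrow> (z, z') \<in> role_int I r"
    by (rule nat_submodel[OF assms(1,2) xd xd], rule that; assumption)
  have "g x \<in> conj_int J M" using x J cJ by (auto simp: conj_int_def)
  moreover have "conj_int J M \<subseteq> cint J B" using assms(3) J(1) by (simp add: entails_conj_def)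
  ultimately show "x \<in> cint I B" using cJ J(2) by auto
qed

lemma entails_role_any_domain:
  fixes I :: "('d, 'c, 'r) interp"
  assumes "finite T" "is_model I T" "entails_role T r s"
  shows "role_int I r \<subseteq> role_int I s"
proof (rule subrelI)
  fix x y assume xy: "(x, y) \<in> role_int I r"
  then have d: "x \<in> domain I" "y \<in> domain I"
    using assms(2) by (cases r; auto simp: is_model_def interpretation_wf_def)+
  obtain J :: "(nat, 'c, 'r) interp" and D g where J: "is_model J T" "x \<in> D" "y \<in> D"
    "D \<subseteq> domain I" "inj_on g D" "domain J = g ` D"
    and cJ: "\<And>A z. z \<in> D \<Longrightarrow> g z \<in> cint J A \<longleftrightarrow> z \<in> cint I A"
    and rJ: "\<And>r z z'. z \<in> D \<Longrightarrow> z' \<in> D \<Longrightarrow> (g z, g z') \<in> role_int J r \<longleftrightarrow> (z, z') \<in> role_int I r"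
    by (rule nat_submodel[OF assms(1,2) d], rule that; assumption)
  have "role_int J r \<subseteq> role_int J s" using assms(3) J(1) by (simp add: entails_role_def)
  then have "(g x, g y) \<in> role_int J s" using rJ[OF J(2,3)] xy by auto
  then show "(x, y) \<in> role_int I s" using rJ[OF J(2,3)] by simp
qed

lemma entails_ex_any_domain:
  fixes I :: "('d, 'c, 'r) interp"
  assumes "finite T" "is_model I T" "entails_ex T M R N"
  shows "conj_int I M \<subseteq> ex_int I R N"
proof
  fix x assume x: "x \<in> conj_int I M"
  then have xd: "x \<in> domain I" by (simp add: conj_int_def)
  obtain J :: "(nat, 'c, 'r) interp" and D g where J: "is_model J T" "x \<in> D" "x \<in> D"
    "D \<subseteq> domain I" "inj_on g D" "domain J = g ` D"
    and cJ: "\<And>A z. z \<in> D \<Longrightarrow> g z \<in> cint J A \<longleftrightarrow> z \<in> cint I A"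
    and rJ: "\<And>r z z'. z \<in> D \<Longrightarrow> z' \<in> D \<Longrightarrow> (g z, g z') \<in> role_int J r \<longleftrightarrow> (z, z') \<in> role_int I r"
    by (rule nat_submodel[OF assms(1,2) xd xd], rule that; assumption)
  have "g x \<in> conj_int J M" using x J cJ by (auto simp: conj_int_def)
  moreover have "conj_int J M \<subseteq> ex_int J R N" using assms(3) J(1) by (simp add: entails_ex_def)
  ultimately have "g x \<in> ex_int J R N" by blast
  then obtain n where n: "\<forall>r\<in>R. (g x, n) \<in> role_int J r" "n \<in> conj_int J N"
    by (auto simp: ex_int_def)
  then obtain z where z: "z \<in> D" "n = g z" using J(6) by (auto simp: conj_int_def)
  then have "\<forall>r\<in>R. (x, z) \<in> role_int I r" "z \<in> conj_int I N"
    using n J rJ cJ by (auto simp: conj_int_def)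
  then show "x \<in> ex_int I R N" using xd by (auto simp: ex_int_def)
qed

section \<open>Good successor configurations\<close>

type_synonym ('c, 'r) two_type = "'c set \<times> 'r role set \<times> 'c set"
type_synonym ('c, 'r) one_half_type = "'r role set \<times> 'c set"

abbreviation pi1 :: "('c, 'r) two_type \<Rightarrow> 'c set" where "pi1 t \<equiv> fst t"
abbreviation pi2 :: "('c, 'r) two_type \<Rightarrow> 'r role set" where "pi2 t \<equiv> fst (snd t)"
abbreviation pi3 :: "('c, 'r) two_type \<Rightarrow> 'c set" where "pi3 t \<equiv> snd (snd t)"

definition inv_type :: "('c, 'r) two_type \<Rightarrow> ('c, 'r) two_type" where
  "inv_type t = (pi3 t, inv_role ` pi2 t, pi1 t)"

definition is_good_succ ::
  "('c, 'r) tbox_axiom set \<Rightarrow> ('c, 'r) two_type set \<Rightarrow> ('c, 'r) one_half_type set \<Rightarrow> bool" where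
  "is_good_succ T F S \<longleftrightarrow>
     (\<forall>t\<in>F. \<forall>M R N. M \<subseteq> pi1 t \<and> entails_ex T M R N
        \<and> \<not> (\<exists>t'\<in>F. R \<subseteq> pi2 t' \<and> N \<subseteq> pi3 t')
        \<longrightarrow> (\<exists>u\<in>S. R \<subseteq> fst u \<and> N \<subseteq> snd u)) \<and>
     (\<forall>u\<in>S. \<exists>t\<in>F. \<exists>M\<subseteq>pi1 t. entails_ex T M (fst u) (snd u)) \<and>
     \<not> (\<exists>u\<in>S. \<exists>u'\<in>S. u \<noteq> u' \<and> fst u \<subseteq> fst u' \<and> snd u \<subseteq> snd u') \<and>
     \<not> (\<exists>u\<in>S. \<exists>t\<in>F. fst u \<subseteq> pi2 t \<and> snd u \<subseteq> pi3 t)"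

definition good_succ ::
  "('c, 'r) tbox_axiom set \<Rightarrow> ('c, 'r) two_type set \<Rightarrow> ('c, 'r) one_half_type set" where
  "good_succ T F = (THE S. is_good_succ T F S)"

text \<open>The last two components \<open>snd t'\<close> of a 2-type \<open>t'\<close> form a 1\<open>\<onehalf>\<close>-type.\<close>

definition is_child ::
  "('c, 'r) tbox_axiom set \<Rightarrow> ('c, 'r) two_type \<Rightarrow> ('c, 'r) two_type \<Rightarrow> bool" where
  "is_child T t' t \<longleftrightarrow> pi1 t' = pi3 t \<and> snd t' \<in> good_succ T {inv_type t}"

section \<open>ABoxes and their closure\<close>

datatype ('c, 'r, 'i) assertion =
    Concept_Assert 'c 'i
  | Role_Assert "'r role" 'i 'i

fun assertion_inds :: "('c, 'r, 'i) assertion \<Rightarrow> 'i set" where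
  "assertion_inds (Concept_Assert A a) = {a}"
| "assertion_inds (Role_Assert r a b) = {a, b}"

definition individuals :: "('c, 'r, 'i) assertion set \<Rightarrow> 'i set" where
  "individuals \<A> = (\<Union>\<alpha>\<in>\<A>. assertion_inds \<alpha>)"

text \<open>
  In the last two rules the filler \<open>B\<close> of the functionality axiom is deliberately not required
  to be in \<open>N\<close>: the rule only relates \<open>A\<close> to \<open>M\<close> and \<open>r\<close> to \<open>R\<close>.
\<close>

inductive_set abox_closure ::
  "('c, 'r) tbox_axiom set \<Rightarrow> ('c, 'r, 'i) assertion set \<Rightarrow> ('c, 'r, 'i) assertion set"
  for T and \<A> where
  base: "\<alpha> \<in> \<A> \<Longrightarrow> \<alpha> \<in> abox_closure T \<A>"
| inverse: "Role_Assert r a b \<in> abox_closure T \<A>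
    \<Longrightarrow> Role_Assert (inv_role r) b a \<in> abox_closure T \<A>"
| conj: "\<lbrakk>entails_conj T M B; a \<in> individuals \<A>; \<forall>A\<in>M. Concept_Assert A a \<in> abox_closure T \<A>\<rbrakk>
    \<Longrightarrow> Concept_Assert B a \<in> abox_closure T \<A>"
| all: "\<lbrakk>Forall A r B \<in> T; Concept_Assert A a \<in> abox_closure T \<A>;
      Role_Assert r a b \<in> abox_closure T \<A>\<rbrakk>
    \<Longrightarrow> Concept_Assert B b \<in> abox_closure T \<A>"
| role: "\<lbrakk>entails_role T r s; Role_Assert r a b \<in> abox_closure T \<A>\<rbrakk>
    \<Longrightarrow> Role_Assert s a b \<in> abox_closure T \<A>"
| func_concept: "\<lbrakk>At_Most_One A r B \<in> T; Concept_Assert A a \<in> abox_closure T \<A>;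
      \<forall>A'\<in>M. Concept_Assert A' a \<in> abox_closure T \<A>;
      Role_Assert r a b \<in> abox_closure T \<A>; Concept_Assert B b \<in> abox_closure T \<A>;
      entails_ex T M R N; A \<in> M; r \<in> R; B' \<in> N\<rbrakk>
    \<Longrightarrow> Concept_Assert B' b \<in> abox_closure T \<A>"
| func_role: "\<lbrakk>At_Most_One A r B \<in> T; Concept_Assert A a \<in> abox_closure T \<A>;
      \<forall>A'\<in>M. Concept_Assert A' a \<in> abox_closure T \<A>;
      Role_Assert r a b \<in> abox_closure T \<A>; Concept_Assert B b \<in> abox_closure T \<A>;
      entails_ex T M R N; A \<in> M; r \<in> R; r' \<in> R\<rbrakk>
    \<Longrightarrow> Role_Assert r' a b \<in> abox_closure T \<A>"

section \<open>The austere canonical model\<close>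

definition concepts_of ::
  "('c, 'r) tbox_axiom set \<Rightarrow> ('c, 'r, 'i) assertion set \<Rightarrow> 'i \<Rightarrow> 'c set" where
  "concepts_of T \<A> a = {A. Concept_Assert A a \<in> abox_closure T \<A>}"

definition roles_of ::
  "('c, 'r) tbox_axiom set \<Rightarrow> ('c, 'r, 'i) assertion set \<Rightarrow> 'i \<Rightarrow> 'i \<Rightarrow> 'r role set" where
  "roles_of T \<A> a b = {r. Role_Assert r a b \<in> abox_closure T \<A>}"

definition ind_types ::
  "('c, 'r) tbox_axiom set \<Rightarrow> ('c, 'r, 'i) assertion set \<Rightarrow> 'i \<Rightarrow> ('c, 'r) two_type set" where
  "ind_types T \<A> a =
     {(concepts_of T \<A> a, {}, {})} \<union>
     {(concepts_of T \<A> a, roles_of T \<A> a b, concepts_of T \<A> b) | b. roles_of T \<A> a b \<noteq> {}}"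

text \<open>
  The pair \<open>(a, [k\<^sub>1, \<dots>, k\<^sub>n])\<close> is the word \<open>a k\<^sub>1 \<dots> k\<^sub>n\<close>; the individual \<open>a\<close> itself is \<open>(a, [])\<close>.
\<close>

type_synonym ('c, 'r, 'i) element = "'i \<times> ('c, 'r) two_type list"

definition can_domain ::
  "('c, 'r) tbox_axiom set \<Rightarrow> ('c, 'r, 'i) assertion set \<Rightarrow> ('c, 'r, 'i) element set" where
  "can_domain T \<A> = {(a, ks). a \<in> individuals \<A> \<and>
     (ks \<noteq> [] \<longrightarrow> pi1 (hd ks) = concepts_of T \<A> a
        \<and> snd (hd ks) \<in> good_succ T (ind_types T \<A> a)) \<and>
     (\<forall>i. Suc i < length ks \<longrightarrow> is_child T (ks ! Suc i) (ks ! i))}"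

definition can ::
  "('c, 'r) tbox_axiom set \<Rightarrow> ('c, 'r, 'i) assertion set
    \<Rightarrow> (('c, 'r, 'i) element, 'c, 'r) interp" where
  "can T \<A> = \<lparr>
     domain = can_domain T \<A>,
     cint = (\<lambda>A. {(a, ks) \<in> can_domain T \<A>.
       A \<in> (if ks = [] then concepts_of T \<A> a else pi3 (last ks))}),
     rint = (\<lambda>r.
       {((a, []), (b, [])) | a b. Role_Assert (Name r) a b \<in> abox_closure T \<A>} \<union>
       {((a, ks), (a, ks @ [k])) | a ks k.
          (a, ks @ [k]) \<in> can_domain T \<A> \<and> Name r \<in> pi2 k} \<union>
       {((a, ks @ [k]), (a, ks)) | a ks k.
          (a, ks @ [k]) \<in> can_domain T \<A> \<and> Inverse r \<in> pi2 k})\<rparr>"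

definition named_elements :: "('c, 'r, 'i) assertion set \<Rightarrow> ('c, 'r, 'i) element set" where
  "named_elements \<A> = (\<lambda>a. (a, [])) ` individuals \<A>"

section \<open>Homomorphisms and cores\<close>

text \<open>\<open>Ind\<close> is the set of individuals, which are domain elements (standard names).\<close>

definition homomorphism ::
  "'d set \<Rightarrow> ('d, 'c, 'r) interp \<Rightarrow> ('d, 'c, 'r) interp \<Rightarrow> ('d \<Rightarrow> 'd) \<Rightarrow> bool" where
  "homomorphism Ind I J h \<longleftrightarrow>
     h ` domain I \<subseteq> domain J \<and> (\<forall>a\<in>Ind. h a = a) \<and>
     (\<forall>A. \<forall>x\<in>domain I. x \<in> cint I A \<longrightarrow> h x \<in> cint J A) \<and>
     (\<forall>r. \<forall>x\<in>domain I. \<forall>y\<in>domain I. (x, y) \<in> rint I r \<longrightarrow> (h x, h y) \<in> rint J r)"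

definition strong_homomorphism ::
  "'d set \<Rightarrow> ('d, 'c, 'r) interp \<Rightarrow> ('d, 'c, 'r) interp \<Rightarrow> ('d \<Rightarrow> 'd) \<Rightarrow> bool" where
  "strong_homomorphism Ind I J h \<longleftrightarrow> homomorphism Ind I J h \<and>
     (\<forall>A. \<forall>x\<in>domain I. x \<in> cint I A \<longleftrightarrow> h x \<in> cint J A) \<and>
     (\<forall>r. \<forall>x\<in>domain I. \<forall>y\<in>domain I. (x, y) \<in> rint I r \<longleftrightarrow> (h x, h y) \<in> rint J r)"

definition embedding ::
  "'d set \<Rightarrow> ('d, 'c, 'r) interp \<Rightarrow> ('d, 'c, 'r) interp \<Rightarrow> ('d \<Rightarrow> 'd) \<Rightarrow> bool" where
  "embedding Ind I J h \<longleftrightarrow> strong_homomorphism Ind I J h \<and> inj_on h (domain I)"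

definition is_core :: "'d set \<Rightarrow> ('d, 'c, 'r) interp \<Rightarrow> bool" where
  "is_core Ind I \<longleftrightarrow> (\<forall>h. homomorphism Ind I I h \<longrightarrow> embedding Ind I I h)"

end

(* Every endomorphism h is the identity.  By induction on words, h fixes w; then h (w k) is a
   neighbour of w that realises at least the 1 1/2-type of k.  It cannot be a named neighbour or
   the parent of w by (R4), so it is a child w k', and (R3) forces k' = k.  Conditions (R3) and
   (R4) are available because good successor configurations exist: only finitely many
   1 1/2-types are entailed by a finite conjunction, and the configuration consists of the
   maximal ones that are not already realised. *)
theory Submission
  imports Defs "HOL-Library.Product_Order"
begin

section \<open>Which names can occur in consequences of the TBox\<close>

fun head_concepts :: "('c, 'r) tbox_axiom \<Rightarrow> 'c set" where
  "head_concepts (Conj_Incl M B) = {B}"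
| "head_concepts (At_Most_One A r B) = {}"
| "head_concepts (Forall A r B) = {B}"
| "head_concepts (Exists A r B) = {B}"
| "head_concepts (Role_Incl r s) = {}"

fun head_roles :: "('c, 'r) tbox_axiom \<Rightarrow> 'r set" where
  "head_roles (Exists A r B) = set_role r"
| "head_roles (Role_Incl r s) = set_role s"
| "head_roles _ = {}"

lemma finite_head_concepts: "finite (head_concepts \<alpha>)"
  by (cases \<alpha>) auto

lemma finite_set_role: "finite (set_role r)"
  by (cases r) auto

lemma finite_head_roles: "finite (head_roles \<alpha>)"
  by (cases \<alpha>) (auto simp: finite_set_role)

lemma finite_roles_over:
  assumes "finite X"
  shows "finite {r. set_role r \<subseteq> X}"
proof -
  have "{r. set_role r \<subseteq> X} \<subseteq> Name ` X \<union> Inverse ` X"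
  proof
    fix r assume "r \<in> {r. set_role r \<subseteq> X}"
    then show "r \<in> Name ` X \<union> Inverse ` X" by (cases r) auto
  qed
  then show ?thesis using assms finite_subset by blast
qed

text \<open>A countermodel for bounding signatures. On a single point every
  \<open>At_Most_One\<close> axiom holds, and the loop interprets a role and its inverse alike, so
  direction is irrelevant and \<open>set_role\<close> suffices.\<close>

definition point_model :: "'c set \<Rightarrow> 'r set \<Rightarrow> (nat, 'c, 'r) interp" where
  "point_model X P = \<lparr>domain = {0}, cint = (\<lambda>A. if A \<in> X then {0} else {}),
     rint = (\<lambda>r. if r \<in> P then {(0, 0)} else {})\<rparr>"

lemma role_int_point_model:
  "role_int (point_model X P) r = (if set_role r \<subseteq> P then {(0, 0)} else {})"
  by (cases r) (auto simp: point_model_def)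

lemma point_model_simps [simp]:
  "domain (point_model X P) = {0}"
  "cint (point_model X P) A = (if A \<in> X then {0} else {})"
  "rint (point_model X P) r = (if r \<in> P then {(0, 0)} else {})"
  by (simp_all add: point_model_def)

text \<open>Once all heads are true at the only point, an existential is witnessed by the point
  itself, and each universal or inclusion has a true conclusion.\<close>

lemma is_model_point_model:
  assumes "\<Union> (head_concepts ` T) \<subseteq> X" and "\<Union> (head_roles ` T) \<subseteq> P"
  shows "is_model (point_model X P) T"
proof -
  have "satisfies (point_model X P) \<alpha>" if "\<alpha> \<in> T" for \<alpha>
  proof -
    have "head_concepts \<alpha> \<subseteq> X" "head_roles \<alpha> \<subseteq> P"
      using assms that by auto
    then show ?thesis
      by (cases \<alpha>)
        (auto simp: role_int_point_model conj_int_def split: if_splits)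
  qed
  then show ?thesis
    by (auto simp: is_model_def interpretation_wf_def)
qed

text \<open>A name outside \<open>X\<close> is false at the point of a model of \<open>T\<close> in
  which all of \<open>M\<close> is true.\<close>

lemma entails_conj_signature:
  assumes "entails_conj T M B" and "M \<subseteq> X" and "\<Union> (head_concepts ` T) \<subseteq> X"
  shows "B \<in> X"
proof -
  let ?I = "point_model X (\<Union> (head_roles ` T))"
  have "conj_int ?I M \<subseteq> cint ?I B"
    using assms(1) is_model_point_model[OF assms(3) order_refl]
    unfolding entails_conj_def by blast
  moreover have "0 \<in> conj_int ?I M"
    using assms(2) by (auto simp: conj_int_def)
  ultimately have "0 \<in> cint ?I B" by blast
  then show ?thesis by (auto split: if_splits)
qed

text \<open>In a one-point model the witness is the point itself, so it carries only concepts from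
  \<open>X\<close> and only the roles put on the loop, here exactly the role names in heads.\<close>

lemma entails_ex_signature:
  assumes "entails_ex T M R N" and "M \<subseteq> X" and "\<Union> (head_concepts ` T) \<subseteq> X"
  shows "R \<subseteq> {r. set_role r \<subseteq> \<Union> (head_roles ` T)}" and "N \<subseteq> X"
proof -
  let ?I = "point_model X (\<Union> (head_roles ` T))"
  have "conj_int ?I M \<subseteq> ex_int ?I R N"
    using assms(1) is_model_point_model[OF assms(3) order_refl]
    unfolding entails_ex_def by blast
  moreover have "0 \<in> conj_int ?I M"
    using assms(2) by (auto simp: conj_int_def)
  ultimately have "0 \<in> ex_int ?I R N" by blast
  then obtain e where e: "\<forall>r\<in>R. (0, e) \<in> role_int ?I r" "e \<in> conj_int ?I N"
    by (auto simp: ex_int_def)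
  show "R \<subseteq> {r. set_role r \<subseteq> \<Union> (head_roles ` T)}"
  proof
    fix r assume "r \<in> R"
    then have "(0, e) \<in> role_int ?I r" using e(1) by blast
    then show "r \<in> {r. set_role r \<subseteq> \<Union> (head_roles ` T)}"
      unfolding role_int_point_model by (simp split: if_splits)
  qed
  show "N \<subseteq> X"
    using e(2) by (auto simp: conj_int_def split: if_splits)
qed

text \<open>The types of names may be infinite; finiteness comes from \<open>T\<close> and
  \<open>X\<close> alone. It is what later provides maximal entailed 1 1/2-types.\<close>

lemma finite_entailed_types:
  assumes "finite T" and "finite X"
  shows "finite {u. \<exists>M\<subseteq>X. entails_ex T M (fst u) (snd u)}"
proof -
  let ?P = "{r. set_role r \<subseteq> \<Union> (head_roles ` T)}"
  let ?X = "X \<union> \<Union> (head_concepts ` T)"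
  have "{u. \<exists>M\<subseteq>X. entails_ex T M (fst u) (snd u)} \<subseteq> Pow ?P \<times> Pow ?X"
  proof
    fix u assume "u \<in> {u. \<exists>M\<subseteq>X. entails_ex T M (fst u) (snd u)}"
    then obtain M where M: "M \<subseteq> ?X" "entails_ex T M (fst u) (snd u)" by blast
    then have "fst u \<subseteq> ?P" "snd u \<subseteq> ?X"
      using entails_ex_signature[OF M(2,1)] by simp_all
    then show "u \<in> Pow ?P \<times> Pow ?X" by (simp only: mem_Times_iff Pow_iff)
  qed
  moreover have "finite (Pow ?P \<times> Pow ?X)"
    using assms by (simp add: finite_roles_over finite_head_roles finite_head_concepts)
  ultimately show ?thesis by (rule finite_subset)
qed

section \<open>Existence and uniqueness of good successor configurations\<close>

lemma
  assumes "is_good_succ T F S"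
  shows is_good_succ_covers: "t \<in> F \<Longrightarrow> M \<subseteq> pi1 t \<Longrightarrow> entails_ex T M R N
      \<Longrightarrow> \<not> (\<exists>t'\<in>F. R \<subseteq> pi2 t' \<and> N \<subseteq> pi3 t') \<Longrightarrow> \<exists>u\<in>S. R \<subseteq> fst u \<and> N \<subseteq> snd u"
    and is_good_succ_entailed: "u \<in> S \<Longrightarrow> \<exists>t\<in>F. \<exists>M\<subseteq>pi1 t. entails_ex T M (fst u) (snd u)"
    and is_good_succ_antichain: "u \<in> S \<Longrightarrow> u' \<in> S \<Longrightarrow> u \<le> u' \<Longrightarrow> u = u'"
    and is_good_succ_fresh: "u \<in> S \<Longrightarrow> \<not> (\<exists>t\<in>F. fst u \<subseteq> pi2 t \<and> snd u \<subseteq> pi3 t)"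
proof -
  note good = assms[unfolded is_good_succ_def]
  show "t \<in> F \<Longrightarrow> M \<subseteq> pi1 t \<Longrightarrow> entails_ex T M R N
      \<Longrightarrow> \<not> (\<exists>t'\<in>F. R \<subseteq> pi2 t' \<and> N \<subseteq> pi3 t') \<Longrightarrow> \<exists>u\<in>S. R \<subseteq> fst u \<and> N \<subseteq> snd u"
    by (rule good[THEN conjunct1, rule_format]) (simp_all only: simp_thms)
  show "u \<in> S \<Longrightarrow> \<exists>t\<in>F. \<exists>M\<subseteq>pi1 t. entails_ex T M (fst u) (snd u)"
    by (rule good[THEN conjunct2, THEN conjunct1, rule_format])
  \<comment> \<open>In the product order \<open>u \<le> u'\<close> is inclusion in both components,
    so (R3) says that \<open>S\<close> is an antichain.\<close>
  show "u \<in> S \<Longrightarrow> u' \<in> S \<Longrightarrow> u \<le> u' \<Longrightarrow> u = u'"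
    using good[THEN conjunct2, THEN conjunct2, THEN conjunct1]
    unfolding less_eq_prod_def by blast
  show "u \<in> S \<Longrightarrow> \<not> (\<exists>t\<in>F. fst u \<subseteq> pi2 t \<and> snd u \<subseteq> pi3 t)"
    using good[THEN conjunct2, THEN conjunct2, THEN conjunct2] by blast
qed

text \<open>Gives meaning to the definite description in \<open>good_succ\<close>, about whose value
  nothing is known until existence and uniqueness are shown.\<close>

lemma is_good_succ_good_succ:
  assumes "finite T" and "finite X" and pi1: "\<And>t. t \<in> F \<Longrightarrow> pi1 t = X"
  shows "is_good_succ T F (good_succ T F)"
proof -
  \<comment> \<open>The candidates: all 1 1/2-types allowed by (R2) and (R4). Relative to
    \<open>C\<close>, (R1) says that a configuration is cofinal and (R3) that it is an
    antichain.\<close>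
  define C where "C = {u. (\<exists>t\<in>F. \<exists>M\<subseteq>pi1 t. entails_ex T M (fst u) (snd u)) \<and>
    \<not> (\<exists>t\<in>F. fst u \<subseteq> pi2 t \<and> snd u \<subseteq> pi3 t)}"
  define S where "S = {u \<in> C. \<forall>v\<in>C. u \<le> v \<longrightarrow> u = v}"
  have "C \<subseteq> {u. \<exists>M\<subseteq>X. entails_ex T M (fst u) (snd u)}"
  proof
    fix u assume "u \<in> C"
    then obtain t M where "t \<in> F" "M \<subseteq> pi1 t" "entails_ex T M (fst u) (snd u)"
      unfolding C_def mem_Collect_eq by (elim conjE bexE exE)
    then show "u \<in> {u. \<exists>M\<subseteq>X. entails_ex T M (fst u) (snd u)}" using pi1 by auto
  qed
  then have "finite C"
    using finite_entailed_types[OF assms(1,2)] by (rule finite_subset)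
  have cofinal: "\<exists>v\<in>S. u \<le> v" if u: "u \<in> C" for u
  proof -
    obtain v where "v \<in> C" "u \<le> v" "\<forall>w\<in>C. v \<le> w \<longrightarrow> v = w"
      using finite_has_maximal2[OF \<open>finite C\<close> u] by (elim bexE conjE)
    then have "v \<in> S" by (simp only: S_def mem_Collect_eq simp_thms)
    then show ?thesis using \<open>u \<le> v\<close> by (rule bexI[rotated])
  qed
  have SC: "S \<subseteq> C" by (simp add: S_def)
  have good: "is_good_succ T F S"
    unfolding is_good_succ_def
  proof (intro conjI)
    show "\<forall>t\<in>F. \<forall>M R N. M \<subseteq> pi1 t \<and> entails_ex T M R N
        \<and> \<not> (\<exists>t'\<in>F. R \<subseteq> pi2 t' \<and> N \<subseteq> pi3 t')
        \<longrightarrow> (\<exists>u\<in>S. R \<subseteq> fst u \<and> N \<subseteq> snd u)"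
    proof (intro ballI allI impI, elim conjE)
      fix t M R N
      assume "t \<in> F" "M \<subseteq> pi1 t" "entails_ex T M R N" "\<not> (\<exists>t'\<in>F. R \<subseteq> pi2 t' \<and> N \<subseteq> pi3 t')"
      then have "(R, N) \<in> C" unfolding C_def mem_Collect_eq fst_conv snd_conv by blast
      then show "\<exists>u\<in>S. R \<subseteq> fst u \<and> N \<subseteq> snd u"
        using cofinal[of "(R, N)"] by (simp only: less_eq_prod_def fst_conv snd_conv)
    qed
    show "\<forall>u\<in>S. \<exists>t\<in>F. \<exists>M\<subseteq>pi1 t. entails_ex T M (fst u) (snd u)"
      using SC unfolding C_def by blast
    show "\<not> (\<exists>u\<in>S. \<exists>u'\<in>S. u \<noteq> u' \<and> fst u \<subseteq> fst u' \<and> snd u \<subseteq> snd u')"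
      unfolding S_def less_eq_prod_def by blast
    show "\<not> (\<exists>u\<in>S. \<exists>t\<in>F. fst u \<subseteq> pi2 t \<and> snd u \<subseteq> pi3 t)"
      using SC unfolding C_def by blast
  qed
  \<comment> \<open>A cofinal antichain inside \<open>C\<close> is the set of maximal elements of
    \<open>C\<close>, which leaves no choice.\<close>
  have unique: "S' = S" if S': "is_good_succ T F S'" for S'
  proof -
    have sub: "S' \<subseteq> C"
      using is_good_succ_entailed[OF S'] is_good_succ_fresh[OF S']
      by (intro subsetI) (simp only: C_def mem_Collect_eq simp_thms)
    have cof: "\<exists>v\<in>S'. u \<le> v" if u: "u \<in> C" for u
    proof -
      obtain t M where "t \<in> F" "M \<subseteq> pi1 t" "entails_ex T M (fst u) (snd u)"
        "\<not> (\<exists>t\<in>F. fst u \<subseteq> pi2 t \<and> snd u \<subseteq> pi3 t)"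
        using u unfolding C_def mem_Collect_eq by (elim conjE bexE exE)
      then show ?thesis
        unfolding less_eq_prod_def by (rule is_good_succ_covers[OF S'])
    qed
    show ?thesis
    proof
      show "S' \<subseteq> S"
      proof
        fix u assume u: "u \<in> S'"
        \<comment> \<open>Cofinality yields \<open>w\<close> in \<open>S'\<close> above
          \<open>v\<close>; the antichain property collapses
          \<open>u \<le> v \<le> w\<close>.\<close>
        have "u = v" if v: "v \<in> C" "u \<le> v" for v
        proof -
          obtain w where w: "w \<in> S'" "v \<le> w" using cof v by blast
          have "u = w"
            using is_good_succ_antichain[OF S' u w(1)] order_trans[OF v(2) w(2)] by simp
          then show ?thesis using v(2) w(2) by simp
        qed
        then show "u \<in> S" using u sub by (auto simp only: S_def)
      qed
      show "S \<subseteq> S'"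
      proof
        fix u assume u: "u \<in> S"
        then obtain v where v: "v \<in> S'" "u \<le> v" using cof SC by blast
        then have "u = v" using u sub by (auto simp only: S_def)
        then show "u \<in> S'" using v(1) by simp
      qed
    qed
  qed
  show ?thesis
    unfolding good_succ_def using good unique by (rule theI)
qed

section \<open>Finiteness of the concept sets in the closure\<close>

lemma finite_concepts_of:
  assumes "finite T" and "finite \<A>"
  shows "finite (concepts_of T \<A> a)"
proof -
  define X where
    "X = {A. \<exists>b. Concept_Assert A b \<in> \<A>} \<union> \<Union> (head_concepts ` T)"
  have sub: "\<Union> (head_concepts ` T) \<subseteq> X" by (auto simp: X_def)
  \<comment> \<open>The closure derives concept and role assertions together, so the invariant
    ranges over both and is trivial on roles. The signature lemmas keep the entailment rules inside
    \<open>X\<close>.\<close>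
  have "case \<alpha> of Concept_Assert A b \<Rightarrow> A \<in> X | Role_Assert r b c \<Rightarrow> True"
    if "\<alpha> \<in> abox_closure T \<A>" for \<alpha>
    using that
  proof induction
    case (base \<alpha>)
    then show ?case by (auto simp: X_def split: assertion.split)
  next
    case (conj M B a)
    then show ?case using entails_conj_signature[OF conj(1) _ sub] by auto
  next
    case (all A r B a b)
    then have "B \<in> \<Union> (head_concepts ` T)" by force
    then show ?case using sub by auto
  next
    case (func_concept A r B a M b R N B')
    then show ?case using entails_ex_signature(2)[OF \<open>entails_ex T M R N\<close> _ sub] by auto
  qed auto
  then have "concepts_of T \<A> a \<subseteq> X" by (fastforce simp: concepts_of_def)
  moreover have "finite X"
  proof -
    \<comment> \<open>The partial \<open>case\<close> yields an unspecified value on role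
      assertions; this is harmless, as only an inclusion into a finite image is claimed.\<close>
    have "{A. \<exists>b. Concept_Assert A b \<in> \<A>} \<subseteq>
      (\<lambda>\<alpha>. case \<alpha> of Concept_Assert A b \<Rightarrow> A) ` \<A>"
      by (force split: assertion.split)
    then have "finite {A. \<exists>b. Concept_Assert A b \<in> \<A>}"
      using assms(2) by (rule finite_surj[rotated])
    then show ?thesis using assms(1) by (simp add: X_def finite_head_concepts)
  qed
  ultimately show ?thesis by (rule finite_subset)
qed

section \<open>Words of the canonical model and their neighbours\<close>

fun label ::
  "('c, 'r) tbox_axiom set \<Rightarrow> ('c, 'r, 'i) assertion set \<Rightarrow> ('c, 'r, 'i) element \<Rightarrow> 'c set" where
  "label T \<A> (a, ks) = (if ks = [] then concepts_of T \<A> a else pi3 (last ks))"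

text \<open>The surroundings against which successors are generated; a proper word sees only its
  parent, by reading its last letter backwards. Together with \<open>label\<close> this treats the
  first letter of a word and all later ones uniformly.\<close>

fun neighbour_types ::
  "('c, 'r) tbox_axiom set \<Rightarrow> ('c, 'r, 'i) assertion set \<Rightarrow> ('c, 'r, 'i) element
    \<Rightarrow> ('c, 'r) two_type set" where
  "neighbour_types T \<A> (a, ks) = (if ks = [] then ind_types T \<A> a else {inv_type (last ks)})"

lemma cint_can: "x \<in> cint (can T \<A>) A \<longleftrightarrow> x \<in> can_domain T \<A> \<and> A \<in> label T \<A> x"
  by (cases x) (auto simp: can_def)

text \<open>Trades the indexed condition for \<open>successively\<close>, which splits over appended
  letters.\<close>

lemma can_domain_iff_successively:
  "(a, ks) \<in> can_domain T \<A> \<longleftrightarrow> a \<in> individuals \<A> \<and>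
     (ks \<noteq> [] \<longrightarrow> pi1 (hd ks) = concepts_of T \<A> a
        \<and> snd (hd ks) \<in> good_succ T (ind_types T \<A> a)) \<and>
     successively (\<lambda>t t'. is_child T t' t) ks"
  by (simp add: can_domain_def successively_conv_nth)

lemma can_domain_snoc:
  "(a, ks @ [k]) \<in> can_domain T \<A> \<longleftrightarrow>
     (a, ks) \<in> can_domain T \<A> \<and> pi1 k = label T \<A> (a, ks)
     \<and> snd k \<in> good_succ T (neighbour_types T \<A> (a, ks))"
  by (cases "ks = []")
    (simp_all add: can_domain_iff_successively successively_append_iff is_child_def conj_ac)

text \<open>Existence needs a finite common first component. For an individual this is
  \<open>finite_concepts_of\<close>. For a word ending in \<open>k\<close> it is
  \<open>pi3 k\<close>, finite because (R2) for the parent's configuration makes it part of an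
  entailment; hence the induction along the word.\<close>

lemma good_succ_neighbour_types:
  assumes "finite T" and "finite \<A>" and "x \<in> can_domain T \<A>"
  shows "is_good_succ T (neighbour_types T \<A> x)
           (good_succ T (neighbour_types T \<A> x))"
proof -
  obtain a ks where x: "x = (a, ks)" by fastforce
  have "(a, ks) \<in> can_domain T \<A> \<Longrightarrow>
    is_good_succ T (neighbour_types T \<A> (a, ks)) (good_succ T (neighbour_types T \<A> (a, ks)))"
  proof (induction ks rule: rev_induct)
    case Nil
    show ?case
      by (rule is_good_succ_good_succ[OF assms(1) finite_concepts_of[OF assms(1,2)]])
        (auto simp: ind_types_def)
  next
    case (snoc k ks)
    then have "snd k \<in> good_succ T (neighbour_types T \<A> (a, ks))"
      "is_good_succ T (neighbour_types T \<A> (a, ks)) (good_succ T (neighbour_types T \<A> (a, ks)))"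
      by (simp_all only: can_domain_snoc)
    then obtain M where "entails_ex T M (pi2 k) (pi3 k)"
      using is_good_succ_entailed by blast
    then have "finite (pi3 k)" by (simp add: entails_ex_def)
    then show ?case
      by (rule is_good_succ_good_succ[OF assms(1)]) (auto simp: inv_type_def)
  qed
  then show ?thesis using assms(3) x by simp
qed

lemma inv_role_inv_role [simp]: "inv_role (inv_role r) = r"
  by (cases r) auto

lemma Role_Assert_inv_role:
  "Role_Assert (inv_role r) b a \<in> abox_closure T \<A> \<longleftrightarrow> Role_Assert r a b \<in> abox_closure T \<A>"
  using abox_closure.inverse[of r a b T \<A>] abox_closure.inverse[of "inv_role r" b a T \<A>] by auto

lemma role_int_can:
  "((a, ks), (b, ls)) \<in> role_int (can T \<A>) r \<longleftrightarrow>
     (ks = [] \<and> ls = [] \<and> Role_Assert r a b \<in> abox_closure T \<A>) \<or>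
     (\<exists>k. b = a \<and> ls = ks @ [k] \<and> (a, ls) \<in> can_domain T \<A> \<and> r \<in> pi2 k) \<or>
     (\<exists>k. b = a \<and> ks = ls @ [k] \<and> (a, ks) \<in> can_domain T \<A> \<and> inv_role r \<in> pi2 k)"
proof (cases r)
  case (Name p)
  then show ?thesis by (auto simp: can_def)
next
  case (Inverse p)
  then show ?thesis using Role_Assert_inv_role[of r b a T \<A>] by (auto simp: can_def)
qed

text \<open>Separates old neighbours from generated ones: named neighbours and the parent are
  recorded in \<open>neighbour_types\<close>, which is what (R4) speaks about, so only children fall
  under the second alternative.\<close>

lemma neighbour_realises:
  assumes dom: "x \<in> can_domain T \<A>"
    and roles: "\<And>r. r \<in> R \<Longrightarrow> (x, y) \<in> role_int (can T \<A>) r" and "R \<noteq> {}"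
    and concepts: "N \<subseteq> label T \<A> y"
  shows "(\<exists>t\<in>neighbour_types T \<A> x. R \<subseteq> pi2 t \<and> N \<subseteq> pi3 t) \<or>
    (\<exists>k. y = (fst x, snd x @ [k]) \<and> y \<in> can_domain T \<A> \<and> R \<subseteq> pi2 k \<and> N \<subseteq> pi3 k)"
proof -
  obtain a ks b ls where xy: "x = (a, ks)" "y = (b, ls)" by fastforce
  note roles' = roles[unfolded xy role_int_can]
  \<comment> \<open>One role decides the kind of neighbour. The three kinds exclude each other by
    word length, so all other roles in \<open>R\<close> are of the same kind.\<close>
  obtain r where "r \<in> R" using \<open>R \<noteq> {}\<close> by blast
  from roles'[OF this] consider
    (named) "ks = []" "ls = []" "Role_Assert r a b \<in> abox_closure T \<A>"
  | (child) k where "b = a" "ls = ks @ [k]" "(a, ls) \<in> can_domain T \<A>"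
  | (parent) k where "b = a" "ks = ls @ [k]"
    by blast
  then show ?thesis
  proof cases
    case named
    have "R \<subseteq> roles_of T \<A> a b"
    proof
      fix r' assume "r' \<in> R"
      from roles'[OF this] named show "r' \<in> roles_of T \<A> a b" by (simp add: roles_of_def)
    qed
    moreover have "(concepts_of T \<A> a, roles_of T \<A> a b, concepts_of T \<A> b)
      \<in> neighbour_types T \<A> x"
      using named xy by (auto simp: ind_types_def roles_of_def)
    moreover have "N \<subseteq> concepts_of T \<A> b" using concepts named xy by simp
    ultimately show ?thesis by (metis fst_conv snd_conv)
  next
    case child
    have "R \<subseteq> pi2 k"
    proof
      fix r' assume "r' \<in> R"
      from roles'[OF this] child(1,2) show "r' \<in> pi2 k" by simp
    qed
    then show ?thesis using child concepts xy by simp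
  next
    case parent
    have "R \<subseteq> inv_role ` pi2 k"
    proof
      fix r' assume "r' \<in> R"
      from roles'[OF this] parent have "inv_role r' \<in> pi2 k" by simp
      then have "inv_role (inv_role r') \<in> inv_role ` pi2 k" by (rule imageI)
      then show "r' \<in> inv_role ` pi2 k" by simp
    qed
    \<comment> \<open>The third component of \<open>inv_type k\<close> is thus exactly the label of
      the parent \<open>y\<close>.\<close>
    moreover have "pi1 k = label T \<A> y"
      using dom can_domain_snoc[of a ls k T \<A>] parent xy by simp
    ultimately show ?thesis using parent concepts xy by (simp add: inv_type_def)
  qed
qed

section \<open>Endomorphisms are the identity\<close>

lemma homomorphism_role_int:
  assumes "homomorphism Ind I J h" and "x \<in> domain I" "y \<in> domain I" and "(x, y) \<in> role_int I r"
  shows "(h x, h y) \<in> role_int J r"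
  using assms by (cases r) (auto simp: homomorphism_def)

lemma domain_can [simp]: "domain (can T \<A>) = can_domain T \<A>"
  by (simp add: can_def)

lemma can_endomorphism_fixes:
  assumes fin: "finite T" "finite \<A>"
    and hom: "homomorphism (named_elements \<A>) (can T \<A>) (can T \<A>) h"
  shows "(a, ks) \<in> can_domain T \<A> \<Longrightarrow> h (a, ks) = (a, ks)"
proof (induction ks rule: rev_induct)
  case Nil
  then have "(a, []) \<in> named_elements \<A>" by (auto simp: can_domain_def named_elements_def)
  then show ?case using hom by (simp add: homomorphism_def)
next
  case (snoc k ks)
  let ?w = "(a, ks)" and ?v = "(a, ks @ [k])"
  let ?F = "neighbour_types T \<A> ?w"
  from snoc.prems have w: "?w \<in> can_domain T \<A>" and k: "pi1 k = label T \<A> ?w"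
    "snd k \<in> good_succ T ?F"
    by (simp_all only: can_domain_snoc)
  have good: "is_good_succ T ?F (good_succ T ?F)"
    using fin w by (rule good_succ_neighbour_types)
  \<comment> \<open>By (R2) the roles of \<open>k\<close> form an entailed role conjunction, and
    those are non-empty; this ties \<open>h ?v\<close> to \<open>?w\<close> by at least one
    edge.\<close>
  obtain M where "entails_ex T M (pi2 k) (pi3 k)"
    using is_good_succ_entailed[OF good k(2)] by blast
  then have "pi2 k \<noteq> {}" by (simp add: entails_ex_def)
  moreover have "(?w, h ?v) \<in> role_int (can T \<A>) r" if "r \<in> pi2 k" for r
  proof -
    have "(?w, ?v) \<in> role_int (can T \<A>) r" using that snoc.prems by (simp add: role_int_can)
    then have "(h ?w, h ?v) \<in> role_int (can T \<A>) r"
      using homomorphism_role_int[OF hom] w snoc.prems by simp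
    then show ?thesis using snoc.IH[OF w] by simp
  qed
  moreover have "pi3 k \<subseteq> label T \<A> (h ?v)"
  proof
    fix A assume "A \<in> pi3 k"
    then have "?v \<in> cint (can T \<A>) A" using snoc.prems by (simp add: cint_can)
    then have "h ?v \<in> cint (can T \<A>) A"
      using hom snoc.prems by (simp add: homomorphism_def)
    then show "A \<in> label T \<A> (h ?v)" by (simp add: cint_can)
  qed
  moreover have "\<not> (\<exists>t\<in>?F. pi2 k \<subseteq> pi2 t \<and> pi3 k \<subseteq> pi3 t)"
    using is_good_succ_fresh[OF good k(2)] .
  ultimately obtain k' where k': "h ?v = (a, ks @ [k'])" "h ?v \<in> can_domain T \<A>"
    "pi2 k \<subseteq> pi2 k'" "pi3 k \<subseteq> pi3 k'"
    using neighbour_realises[OF w, of "pi2 k" "h ?v" "pi3 k"] by auto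
  \<comment> \<open>Both letters extend the same word, so their 1 1/2-types lie in one
    configuration, where comparable members are equal; their first components are both the label of
    \<open>?w\<close>.\<close>
  then have "pi1 k' = label T \<A> ?w" "snd k' \<in> good_succ T ?F"
    using can_domain_snoc[of a ks k' T \<A>] by auto
  moreover from this have "snd k = snd k'"
    using is_good_succ_antichain[OF good k(2)] k'(3,4) by (simp add: less_eq_prod_def)
  ultimately have "k' = k" using k(1) by (simp add: prod_eq_iff)
  then show ?case using k'(1) by simp
qed

theorem mainTheorem3:
  fixes T :: "('c, 'r) tbox_axiom set" and \<A> :: "('c, 'r, 'i) assertion set"
  assumes "normalised_tbox T" and "finite \<A>"
  shows "is_core (named_elements \<A>) (can T \<A>)"
  unfolding is_core_def
proof (intro allI impI)
  fix h assume hom: "homomorphism (named_elements \<A>) (can T \<A>) (can T \<A>) h"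
  have "finite T" using assms(1) by (simp add: normalised_tbox_def)
  \<comment> \<open>A homomorphism is constrained only on the domain, so the identity is claimed
    only there; it is trivially strong and injective.\<close>
  then have "h x = x" if "x \<in> domain (can T \<A>)" for x
    using can_endomorphism_fixes[OF _ assms(2) hom] that by (cases x) simp
  then show "embedding (named_elements \<A>) (can T \<A>) (can T \<A>) h"
    using hom by (simp add: embedding_def strong_homomorphism_def inj_on_def)
qed

end
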